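(* For every positive integer $n$, with $m = \lfloor (n-1)/2 \rfloor$, each of the four polynomials $R_n^{B,>,+}(t)$, $R_n^{B,>,-}(t)$, $R_n^{B,<,+}(t)$, $R_n^{B,<,-}(t)$ is divisible by $(1+t)^m$.
   Context: $\mathfrak{B}_n$ is the set of signed permutations of $[n]$, written as words $\pi = \pi_1,\ldots,\pi_n$ with $\pi_i \in \{\pm 1,\ldots,\pm n\}$ and $|\pi_1|,\ldots,|\pi_n|$ a permutation of $[n]$. Set $\pi_0 = 0$. For $1 \leq i \leq n-1$, $\pi$ changes direction at $i$ if $\pi_{i-1} < \pi_i > \pi_{i+1}$ or $\pi_{i-1} > \pi_i < \pi_{i+1}$; $\mathrm{altruns}_B(\pi)$ is $1$ plus the number of such indices. $\mathsf{Negs}(\pi) = \{\pi_i : \pi_i < 0\}$ and $\mathsf{inv}_B(\pi) = |\{1 \le i<j \le n : \pi_i > \pi_j\}| + |\{1 \le i<j \le n : -\pi_i > \pi_j\}| + |\mathsf{Negs}(\pi)|$. Let $\mathfrak{B}_n^+$ (resp. $\mathfrak{B}_n^-$) be the set of $\pi \in \mathfrak{B}_n$ with $\mathsf{inv}_B(\pi)$ even (resp. odd), $\mathfrak{B}_n^> = \{\pi : \pi_1 > 0\}$, $\mathfrak{B}_n^< = \{\pi : \pi_1 < 0\}$, and $\mathfrak{B}_n^{>,\pm} = \mathfrak{B}_n^> \cap \mathfrak{B}_n^{\pm}$, $\mathfrak{B}_n^{<,\pm} = \mathfrak{B}_n^< \cap \mathfrak{B}_n^{\pm}$. Define $R_n^{B,>,\pm}(t)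 = \sum_{\pi \in \mathfrak{B}_n^{>,\pm}} t^{\mathrm{altruns}_B(\pi)}$ and $R_n^{B,<,\pm}(t) = \sum_{\pi \in \mathfrak{B}_n^{<,\pm}} t^{\mathrm{altruns}_B(\pi)}$. *)

theory Defs
  imports
    "HOL-Computational_Algebra.Polynomial"
    "HOL-Combinatorics.Multiset_Permutations"
begin

text \<open>A signed permutation is the word of its values, an integer list
  whose list of absolute values is a permutation of \<open>{1..n}\<close>.\<close>

definition signed_perms :: "nat \<Rightarrow> int list set" where
  "signed_perms n = {w. map abs w \<in> permutations_of_set {1..int n}}"

text \<open>Positions are counted from 1, and \<open>letter w 0 = 0\<close>.\<close>

definition letter :: "int list \<Rightarrow> nat \<Rightarrow> int" where
  "letter w i = (0 # w) ! i"

definition changes_direction :: "int list \<Rightarrow> nat \<Rightarrow> bool" where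
  "changes_direction w i \<longleftrightarrow>
     letter w (i - 1) < letter w i \<and> letter w i > letter w (i + 1) \<or>
     letter w (i - 1) > letter w i \<and> letter w i < letter w (i + 1)"

definition altruns_B :: "int list \<Rightarrow> nat" where
  "altruns_B w = 1 + card {i. 1 \<le> i \<and> i \<le> length w - 1 \<and> changes_direction w i}"

definition Negs :: "int list \<Rightarrow> int set" where
  "Negs w = {x \<in> set w. x < 0}"

definition inv_B :: "int list \<Rightarrow> nat" where
  "inv_B w =
     card {(i, j). 1 \<le> i \<and> i < j \<and> j \<le> length w \<and> letter w i > letter w j} +
     card {(i, j). 1 \<le> i \<and> i < j \<and> j \<le> length w \<and> - letter w i > letter w j} +
     card (Negs w)"

definition B_plus :: "nat \<Rightarrow> int list set" where
  "B_plus n = {w \<in> signed_perms n. even (inv_B w)}"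

definition B_minus :: "nat \<Rightarrow> int list set" where
  "B_minus n = {w \<in> signed_perms n. odd (inv_B w)}"

definition B_gt :: "nat \<Rightarrow> int list set" where
  "B_gt n = {w \<in> signed_perms n. letter w 1 > 0}"

definition B_lt :: "nat \<Rightarrow> int list set" where
  "B_lt n = {w \<in> signed_perms n. letter w 1 < 0}"

definition altruns_poly :: "int list set \<Rightarrow> int poly" where
  "altruns_poly S = (\<Sum>w\<in>S. monom 1 (altruns_B w))"

definition R_gt_plus :: "nat \<Rightarrow> int poly" where
  "R_gt_plus n = altruns_poly (B_gt n \<inter> B_plus n)"

definition R_gt_minus :: "nat \<Rightarrow> int poly" where
  "R_gt_minus n = altruns_poly (B_gt n \<inter> B_minus n)"

definition R_lt_plus :: "nat \<Rightarrow> int poly" where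
  "R_lt_plus n = altruns_poly (B_lt n \<inter> B_plus n)"

definition R_lt_minus :: "nat \<Rightarrow> int poly" where
  "R_lt_minus n = altruns_poly (B_lt n \<inter> B_minus n)"

text \<open>Finiteness, so that the sum in \<open>altruns_poly\<close> is a genuine one.\<close>

lemma finite_signed_perms: "finite (signed_perms n)"
proof (rule finite_subset)
  show "signed_perms n \<subseteq> {w. set w \<subseteq> {- int n..int n} \<and> length w = n}"
  proof
    fix w assume "w \<in> signed_perms n"
    then have s: "abs ` set w = {1..int n}" and d: "distinct (map abs w)"
      by (auto simp: signed_perms_def permutations_of_set_def)
    have "length w = card (set (map abs w))"
      using d distinct_card by fastforce
    moreover have "\<bar>x\<bar> \<le> int n" if "x \<in> set w" for x
      using s that by (metis atLeastAtMost_iff image_eqI)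
    ultimately show "w \<in> {w. set w \<subseteq> {- int n..int n} \<and> length w = n}"
      using s by (auto simp: abs_le_iff minus_le_iff)
  qed
  show "finite {w. set w \<subseteq> {- int n..int n} \<and> length w = n}"
    by (rule finite_lists_length_eq) simp
qed

end

theory Submission
  imports Defs
begin

text \<open>Negating all letters after position \<open>d\<close> reverses every comparison between neighbouring
  letters beyond \<open>d\<close>, and reverses the one between positions \<open>d\<close> and \<open>d + 1\<close> precisely if
  the absolute value increases there. Hence exactly one direction change is switched on or off: the
  one at \<open>d\<close> or the one at \<open>d + 1\<close>, and which of the two depends on absolute values only.
  Modulo 2, \<open>inv_B\<close> is the number of inversions of the word of absolute values plus the number of
  negative letters, so it keeps its parity if the negated suffix has even length. The values
  \<open>d = n - 2, n - 4, \<dots>\<close> with \<open>d \<ge> 1\<close> thus give \<open>(n - 1) div 2\<close> involutions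
  acting on disjoint places, each of which contributes a factor \<open>1 + t\<close>.\<close>

section \<open>Factors 1 + t from independent toggles\<close>

text \<open>By induction on \<open>m\<close>: \<open>g m\<close> maps the half of \<open>S\<close>
  where \<open>P m\<close> fails onto the half where it holds and raises \<open>f\<close> by one, so
  the whole sum is 1 + t times the sum over the first half. That half stays closed under the
  remaining \<open>g k\<close>, because these keep \<open>P m\<close>.\<close>

lemma power_dvd_sum_monom_toggles:
  fixes f :: "'a \<Rightarrow> nat" and g :: "nat \<Rightarrow> 'a \<Rightarrow> 'a" and P :: "nat \<Rightarrow> 'a \<Rightarrow> bool"
  assumes "finite S"
    and closed: "\<And>k w. k < m \<Longrightarrow> w \<in> S \<Longrightarrow> g k w \<in> S"
    and invol: "\<And>k w. k < m \<Longrightarrow> w \<in> S \<Longrightarrow> g k (g k w) = w"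
    and toggle: "\<And>k w. k < m \<Longrightarrow> w \<in> S \<Longrightarrow> P k (g k w) \<longleftrightarrow> \<not> P k w"
    and keep: "\<And>j k w. j < m \<Longrightarrow> k < m \<Longrightarrow> j \<noteq> k \<Longrightarrow> w \<in> S \<Longrightarrow> P j (g k w) \<longleftrightarrow> P j w"
    and weight: "\<And>k w. k < m \<Longrightarrow> w \<in> S \<Longrightarrow> \<not> P k w \<Longrightarrow> f (g k w) = Suc (f w)"
  shows "[:1, 1:] ^ m dvd (\<Sum>w\<in>S. monom (1 :: 'b :: comm_ring_1) (f w))"
  using assms
proof (induction m arbitrary: S)
  case 0
  then show ?case by simp
next
  case (Suc m)
  let ?S0 = "{w \<in> S. \<not> P m w}" and ?S1 = "{w \<in> S. P m w}"
  let ?F = "\<lambda>A. \<Sum>w\<in>A. monom (1 :: 'b) (f w)"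
  have IH: "[:1, 1:] ^ m dvd ?F ?S0"
    by (rule Suc.IH) (use Suc.prems in auto)
  have bij: "bij_betw (g m) ?S0 ?S1"
    by (rule bij_betw_byWitness[where f' = "g m"]) (use Suc.prems in auto)
  have x: "monom (1 :: 'b) 1 = [:0, 1:]"
    by (simp add: monom_Suc monom_0)
  have "?F ?S1 = (\<Sum>w\<in>?S0. monom 1 (f (g m w)))"
    by (rule sum.reindex_bij_betw[OF bij, symmetric])
  also have "\<dots> = (\<Sum>w\<in>?S0. monom 1 1 * monom 1 (f w))"
    by (rule sum.cong) (use Suc.prems(6) in \<open>auto simp: mult_monom\<close>)
  also have "\<dots> = monom 1 1 * ?F ?S0"
    by (rule sum_distrib_left[symmetric])
  finally have S1: "?F ?S1 = [:0, 1:] * ?F ?S0"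
    by (simp only: x)
  have "?F S = ?F (?S0 \<union> ?S1)"
    by (rule sum.cong) auto
  also have "\<dots> = ?F ?S0 + ?F ?S1"
    by (rule sum.union_disjoint) (use Suc.prems(1) in auto)
  also have "\<dots> = [:1, 1:] * ?F ?S0"
    by (simp add: S1)
  finally show ?case
    using mult_dvd_mono[OF dvd_refl IH, of "[:1, 1:]"] by simp
qed

section \<open>Negating a suffix of a signed permutation\<close>

definition neg_suffix :: "nat \<Rightarrow> int list \<Rightarrow> int list" where
  "neg_suffix d w = take d w @ map uminus (drop d w)"

lemma length_neg_suffix [simp]: "length (neg_suffix d w) = length w"
  by (simp add: neg_suffix_def)

lemma neg_suffix_neg_suffix [simp]: "neg_suffix d (neg_suffix d w) = w"
  by (cases "d \<le> length w") (simp_all add: neg_suffix_def o_def)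

lemma letter_neg_suffix:
  assumes "j \<le> length w"
  shows "letter (neg_suffix d w) j = (if j \<le> d then letter w j else - letter w j)"
proof (cases j)
  case 0
  then show ?thesis
    by (simp add: letter_def)
next
  case (Suc i)
  then have i: "i < length w"
    using assms by simp
  \<comment> \<open>List index \<open>i\<close> is position \<open>i + 1\<close>, so
    \<open>i < d\<close> here is \<open>j \<le> d\<close> in the claim.\<close>
  have "neg_suffix d w ! i = (if i < d then w ! i else - w ! i)"
  proof (cases "i < d")
    case True
    then show ?thesis
      using i by (simp add: neg_suffix_def nth_append)
  next
    case False
    then have "neg_suffix d w ! i = map uminus (drop d w) ! (i - d)"
      using i by (simp add: neg_suffix_def nth_append)
    also have "\<dots> = - drop d w ! (i - d)"
      using False i by (intro nth_map) simp
    also have "drop d w ! (i - d) = w ! i"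
      using False i by simp
    finally show ?thesis
      using False by simp
  qed
  then show ?thesis
    using Suc by (simp add: letter_def Suc_le_eq)
qed

lemma abs_letter_neg_suffix:
  assumes "j \<le> length w"
  shows "\<bar>letter (neg_suffix d w) j\<bar> = \<bar>letter w j\<bar>"
  using assms by (simp add: letter_neg_suffix)

lemma map_abs_neg_suffix [simp]: "map abs (neg_suffix d w) = map abs w"
proof -
  have "map abs (neg_suffix d w) = map abs (take d w) @ map abs (drop d w)"
    by (simp add: neg_suffix_def)
  then show ?thesis
    by (simp flip: map_append)
qed

lemma neg_suffix_in_signed_perms [simp]:
  "neg_suffix d w \<in> signed_perms n \<longleftrightarrow> w \<in> signed_perms n"
  by (simp add: signed_perms_def)

lemma length_signed_perm: "w \<in> signed_perms n \<Longrightarrow> length w = n"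
  using length_finite_permutations_of_set[of "map abs w" "{1..int n}"]
  by (simp add: signed_perms_def)

text \<open>Position 0 is covered too: its letter 0 lies outside \<open>{1..int n}\<close>.\<close>

lemma inj_abs_letter_signed_perm:
  assumes "w \<in> signed_perms n" "i \<le> n" "j \<le> n" "i \<noteq> j"
  shows "\<bar>letter w i\<bar> \<noteq> \<bar>letter w j\<bar>"
proof -
  have "distinct (map abs (0 # w))"
    using assms(1) by (auto simp: signed_perms_def permutations_of_set_def)
  then have "map abs (0 # w) ! i \<noteq> map abs (0 # w) ! j"
    by (subst nth_eq_iff_index_eq) (use assms length_signed_perm[OF assms(1)] in auto)
  then show ?thesis
    using assms length_signed_perm[OF assms(1)] by (simp add: letter_def del: list.map)
qed

section \<open>Direction changes\<close>

text \<open>In a signed permutation this is the border: \<open>neg_suffix d\<close> preserves the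
  comparison of positions \<open>k - 1\<close> and \<open>k\<close> iff
  \<open>k \<le> toggle_pos d w\<close>, and reverses it otherwise.\<close>

definition toggle_pos :: "nat \<Rightarrow> int list \<Rightarrow> nat" where
  "toggle_pos d w = (if \<bar>letter w d\<bar> < \<bar>letter w (d + 1)\<bar> then d else d + 1)"

lemma toggle_pos_neg_suffix:
  assumes "d + 1 \<le> length w"
  shows "toggle_pos d (neg_suffix e w) = toggle_pos d w"
  using assms by (simp add: toggle_pos_def abs_letter_neg_suffix)

text \<open>Neighbouring letters never tie, so a change is a disagreement of two comparisons; in
  this form it is easy to trace what reversing one of them does.\<close>

lemma changes_direction_iff:
  assumes w: "w \<in> signed_perms n" and "1 \<le> j" "j < n"
  shows "changes_direction w j \<longleftrightarrow>
    (letter w (j - 1) < letter w j \<longleftrightarrow> \<not> letter w j < letter w (j + 1))"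
proof -
  have "\<bar>letter w (j - 1)\<bar> \<noteq> \<bar>letter w j\<bar>" "\<bar>letter w j\<bar> \<noteq> \<bar>letter w (j + 1)\<bar>"
    by (rule inj_abs_letter_signed_perm[OF w]; use assms in simp)+
  then have "letter w (j - 1) \<noteq> letter w j" "letter w j \<noteq> letter w (j + 1)"
    by metis+
  then show ?thesis
    unfolding changes_direction_def by linarith
qed

text \<open>The final disjunction says when the comparison is preserved. For
  \<open>k = d + 1\<close> only the right letter is negated; the letter of larger absolute value
  decides the comparison by its sign, so it is reversed iff that letter is the right one.\<close>

lemma ascent_neg_suffix_iff:
  assumes w: "w \<in> signed_perms n" and "1 \<le> k" "k \<le> n"
  shows "letter (neg_suffix d w) (k - 1) < letter (neg_suffix d w) k \<longleftrightarrow>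
    (letter w (k - 1) < letter w k \<longleftrightarrow>
      k \<le> d \<or> k = d + 1 \<and> \<not> \<bar>letter w d\<bar> < \<bar>letter w (d + 1)\<bar>)"
proof -
  have len: "length w = n"
    using w by (rule length_signed_perm)
  have ne: "\<bar>letter w (k - 1)\<bar> \<noteq> \<bar>letter w k\<bar>"
    by (rule inj_abs_letter_signed_perm[OF w]) (use assms in auto)
  consider "k \<le> d" | "k = d + 1" | "k > d + 1"
    by linarith
  then show ?thesis
  proof cases
    case 1
    then have "k - 1 \<le> d"
      by simp
    with 1 show ?thesis
      using assms len by (simp add: letter_neg_suffix)
  next
    case 2
    have "x < - y \<longleftrightarrow> (x < y \<longleftrightarrow> \<not> \<bar>x\<bar> < \<bar>y\<bar>)" if "\<bar>x\<bar> \<noteq> \<bar>y\<bar>" for x y :: int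
      using that by linarith
    from this[OF ne] show ?thesis
      using 2 assms len by (simp add: letter_neg_suffix)
  next
    case 3
    then show ?thesis
      using assms len ne by (auto simp: letter_neg_suffix)
  qed
qed

text \<open>A change at \<open>j\<close> flips iff exactly one of the two comparisons meeting at
  \<open>j\<close> is reversed, which happens only at the border.\<close>

lemma changes_direction_neg_suffix:
  assumes w: "w \<in> signed_perms n" and "1 \<le> d" "d + 1 < n" and j: "1 \<le> j" "j < n"
  shows "changes_direction (neg_suffix d w) j \<longleftrightarrow>
    (if j = toggle_pos d w then \<not> changes_direction w j else changes_direction w j)"
proof -
  have w': "neg_suffix d w \<in> signed_perms n"
    using w by simp
  have left: "letter (neg_suffix d w) (j - 1) < letter (neg_suffix d w) j \<longleftrightarrow>
    (letter w (j - 1) < letter w j \<longleftrightarrow>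
      j \<le> d \<or> j = d + 1 \<and> \<not> \<bar>letter w d\<bar> < \<bar>letter w (d + 1)\<bar>)"
    by (rule ascent_neg_suffix_iff[OF w]) (use j in auto)
  have right: "letter (neg_suffix d w) j < letter (neg_suffix d w) (j + 1) \<longleftrightarrow>
    (letter w j < letter w (j + 1) \<longleftrightarrow>
      j + 1 \<le> d \<or> j = d \<and> \<not> \<bar>letter w d\<bar> < \<bar>letter w (d + 1)\<bar>)"
    using ascent_neg_suffix_iff[OF w, of "j + 1" d] j by simp
  consider "j < d" | "j = d" | "j = d + 1" | "j > d + 1"
    by linarith
  then show ?thesis
    unfolding changes_direction_iff[OF w' j] changes_direction_iff[OF w j] left right
      toggle_pos_def
    by cases auto
qed

lemma altruns_B_neg_suffix:
  assumes w: "w \<in> signed_perms n" and d: "1 \<le> d" "d + 1 < n"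
    and no: "\<not> changes_direction w (toggle_pos d w)"
  shows "altruns_B (neg_suffix d w) = Suc (altruns_B w)"
proof -
  let ?v = "toggle_pos d w"
  let ?C = "\<lambda>w. {i. 1 \<le> i \<and> i \<le> length w - 1 \<and> changes_direction w i}"
  have len: "length w = n"
    using w by (rule length_signed_perm)
  have v: "1 \<le> ?v" "?v \<le> n - 1"
    using d by (auto simp: toggle_pos_def)
  \<comment> \<open>Both candidates \<open>d\<close> and \<open>d + 1\<close> lie among the
    positions 1 to \<open>n - 1\<close> that \<open>altruns_B\<close> counts.\<close>
  have "?C (neg_suffix d w) = insert ?v (?C w)"
    using changes_direction_neg_suffix[OF w d] no v len by (auto split: if_splits)
  moreover have "finite (?C w)"
    by (rule finite_subset[of _ "{..length w}"]) auto
  ultimately show ?thesis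
    using no by (simp add: altruns_B_def)
qed

section \<open>Parity of \<open>inv_B\<close>\<close>

text \<open>For letters a before b, exactly one of a > b and -a > b holds if |a| > |b|; if |a| <
  |b|, both or neither hold, according to the sign of b. So the first two counts of
  \<open>inv_B\<close> differ from the inversions of the absolute values by an even number.\<close>

lemma even_inv_B_iff:
  assumes w: "w \<in> signed_perms n"
  shows "even (inv_B w) \<longleftrightarrow>
    even (card {(i, j). 1 \<le> i \<and> i < j \<and> j \<le> n \<and> \<bar>letter w i\<bar> > \<bar>letter w j\<bar>} + card (Negs w))"
proof -
  let ?X = "{(i, j). 1 \<le> i \<and> i < j \<and> j \<le> n \<and> letter w i > letter w j}"
  let ?Y = "{(i, j). 1 \<le> i \<and> i < j \<and> j \<le> n \<and> - letter w i > letter w j}"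
  let ?Z = "{(i, j). 1 \<le> i \<and> i < j \<and> j \<le> n \<and> \<bar>letter w i\<bar> > \<bar>letter w j\<bar>}"
  have fin: "finite ?X" "finite ?Y"
    by (rule finite_subset[of _ "{..n} \<times> {..n}"]; auto)+
  have "?Z = (?X \<union> ?Y) - (?X \<inter> ?Y)"
  proof (rule set_eqI, clarify)
    fix i j
    show "(i, j) \<in> ?Z \<longleftrightarrow> (i, j) \<in> (?X \<union> ?Y) - (?X \<inter> ?Y)"
    proof (cases "1 \<le> i \<and> i < j \<and> j \<le> n")
      case True
      then have "\<bar>letter w i\<bar> \<noteq> \<bar>letter w j\<bar>"
        by (intro inj_abs_letter_signed_perm[OF w]) auto
      then have "\<bar>letter w i\<bar> > \<bar>letter w j\<bar> \<longleftrightarrow>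
          (letter w i > letter w j \<longleftrightarrow> \<not> - letter w i > letter w j)"
        by linarith
      then show ?thesis
        by blast
    qed blast
  qed
  moreover have "card ((?X \<union> ?Y) - (?X \<inter> ?Y)) = card (?X \<union> ?Y) - card (?X \<inter> ?Y)"
    by (rule card_Diff_subset) (use fin in auto)
  \<comment> \<open>This keeps the subtraction of cardinalities from truncating.\<close>
  moreover have "card (?X \<inter> ?Y) \<le> card (?X \<union> ?Y)"
    using fin by (intro card_mono) auto
  moreover have "card ?X + card ?Y = card (?X \<union> ?Y) + card (?X \<inter> ?Y)"
    using fin by (rule card_Un_Int)
  ultimately have "card ?X + card ?Y = card ?Z + 2 * card (?X \<inter> ?Y)"
    by presburger
  then show ?thesis
    unfolding inv_B_def length_signed_perm[OF w] by simp
qed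

text \<open>A count along the list splits over \<open>take\<close> and \<open>drop\<close>.\<close>

lemma card_Negs_signed_perm:
  assumes "w \<in> signed_perms n"
  shows "card (Negs w) = length (filter (\<lambda>x. x < 0) w)"
proof -
  have "distinct w"
    using assms by (auto simp: signed_perms_def permutations_of_set_def distinct_map)
  then show ?thesis
    by (simp add: Negs_def distinct_card flip: set_filter)
qed

text \<open>As 0 is no letter, the negative letters of the suffix before and after negation add up
  to \<open>n - d\<close>; an even total forces equal parities.\<close>

lemma even_inv_B_neg_suffix:
  assumes w: "w \<in> signed_perms n" and "d \<le> n" "even (n - d)"
  shows "even (inv_B (neg_suffix d w)) \<longleftrightarrow> even (inv_B w)"
proof -
  have len: "length w = n"
    using w by (rule length_signed_perm)
  let ?neg = "\<lambda>w. length (filter (\<lambda>x :: int. x < 0) w)"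
  let ?s = "drop d w"
  have "0 \<notin> abs ` set w"
    using w by (auto simp: signed_perms_def permutations_of_set_def)
  then have "0 \<notin> set ?s"
    using set_drop_subset[of d w] by force
  then have "filter (\<lambda>x. - x < 0) ?s = filter (\<lambda>x. \<not> x < 0) ?s"
    by (intro filter_cong) (auto simp: less_le)
  then have "?neg (map uminus ?s) = length (filter (\<lambda>x. \<not> x < 0) ?s)"
    by (simp add: filter_map o_def)
  then have "?neg ?s + ?neg (map uminus ?s) = n - d"
    using sum_length_filter_compl[of "\<lambda>x. x < 0" ?s] len by simp
  then have "even (?neg (map uminus ?s)) \<longleftrightarrow> even (?neg ?s)"
    using assms(3) by (metis even_add)
  moreover have "?neg w = ?neg (take d w) + ?neg ?s"
    unfolding filter_append[symmetric] length_append[symmetric] append_take_drop_id ..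
  moreover have "?neg (neg_suffix d w) = ?neg (take d w) + ?neg (map uminus ?s)"
    unfolding neg_suffix_def filter_append length_append ..
  ultimately have "even (?neg (neg_suffix d w)) \<longleftrightarrow> even (?neg w)"
    by (simp only: even_add)
  then have negs: "even (card (Negs (neg_suffix d w))) \<longleftrightarrow> even (card (Negs w))"
    using w by (simp only: card_Negs_signed_perm[of _ n] neg_suffix_in_signed_perms)
  have "{(i, j). 1 \<le> i \<and> i < j \<and> j \<le> n \<and>
        \<bar>letter (neg_suffix d w) i\<bar> > \<bar>letter (neg_suffix d w) j\<bar>}
      = {(i, j). 1 \<le> i \<and> i < j \<and> j \<le> n \<and> \<bar>letter w i\<bar> > \<bar>letter w j\<bar>}"
    using len by (intro Collect_cong) (auto simp: abs_letter_neg_suffix)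
  then show ?thesis
    using negs w by (simp add: even_inv_B_iff[of _ n])
qed

section \<open>Divisibility for the four classes\<close>

lemma power_dvd_altruns_poly:
  assumes sub: "S \<subseteq> signed_perms n"
    and closed: "\<And>d w. 1 \<le> d \<Longrightarrow> d \<le> n \<Longrightarrow> even (n - d) \<Longrightarrow> w \<in> S \<Longrightarrow> neg_suffix d w \<in> S"
  shows "[:1, 1:] ^ ((n - 1) div 2) dvd altruns_poly S"
proof -
  \<comment> \<open>The suffix has even length \<open>2 * k + 2\<close>, and
    \<open>k < (n - 1) div 2\<close> says exactly that it leaves at least one letter in
    front.\<close>
  define d where "d k = n - (2 * k + 2)" for k
  define P where "P k w = changes_direction w (toggle_pos (d k) w)" for k w
  have d: "1 \<le> d k" "d k + 1 < n" "n = d k + (2 * k + 2)" if "k < (n - 1) div 2" for k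
  proof -
    have "2 * k + 2 < n"
      using that by linarith
    then show "1 \<le> d k" "d k + 1 < n" "n = d k + (2 * k + 2)"
      unfolding d_def by linarith+
  qed
  have pos: "1 \<le> toggle_pos (d k) w" "toggle_pos (d k) w < n" if "k < (n - 1) div 2" for k w
    using d(1,2)[OF that] by (simp_all add: toggle_pos_def)
  have same: "toggle_pos (d j) (neg_suffix (d k) w) = toggle_pos (d j) w"
    if "j < (n - 1) div 2" "w \<in> S" for j k w
    using d(2)[OF that(1)] length_signed_perm[OF subsetD[OF sub that(2)]]
    by (intro toggle_pos_neg_suffix) simp
  show ?thesis
    unfolding altruns_poly_def
  proof (rule power_dvd_sum_monom_toggles[where g = "\<lambda>k. neg_suffix (d k)" and P = P])
    show "finite S"
      using sub finite_signed_perms by (rule finite_subset)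
  next
    fix k w assume k: "k < (n - 1) div 2" and w: "w \<in> S"
    show "neg_suffix (d k) w \<in> S"
    proof (rule closed[OF d(1)[OF k] _ _ w])
      show "d k \<le> n"
        using d(2)[OF k] by linarith
      show "even (n - d k)"
        by (subst d(3)[OF k]) simp
    qed
    show "neg_suffix (d k) (neg_suffix (d k) w) = w"
      by simp
    show "P k (neg_suffix (d k) w) \<longleftrightarrow> \<not> P k w"
      unfolding P_def same[OF k w]
      using changes_direction_neg_suffix[OF subsetD[OF sub w] d(1,2)[OF k] pos[OF k]] by simp
    show "altruns_B (neg_suffix (d k) w) = Suc (altruns_B w)" if "\<not> P k w"
      using that unfolding P_def by (rule altruns_B_neg_suffix[OF subsetD[OF sub w] d(1,2)[OF k]])
  next
    fix j k w
    assume j: "j < (n - 1) div 2" and k: "k < (n - 1) div 2" and "j \<noteq> k" and w: "w \<in> S"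
    \<comment> \<open>Distinct values of \<open>d\<close> differ by at least 2, so the candidate
      pairs \<open>d\<close>, \<open>d + 1\<close> are disjoint.\<close>
    have "d j + 1 < d k \<or> d k + 1 < d j"
      using d(3)[OF j] d(3)[OF k] \<open>j \<noteq> k\<close> by arith
    then have "toggle_pos (d j) w \<noteq> toggle_pos (d k) w"
      by (auto simp: toggle_pos_def)
    then show "P j (neg_suffix (d k) w) \<longleftrightarrow> P j w"
      unfolding P_def same[OF j w]
      using changes_direction_neg_suffix[OF subsetD[OF sub w] d(1,2)[OF k] pos[OF j]] by simp
  qed
qed

theorem theorem11:
  fixes n m :: nat
  assumes "n \<ge> 1" and "m = (n - 1) div 2"
  shows "[:1, 1:] ^ m dvd R_gt_plus n \<and> [:1, 1:] ^ m dvd R_gt_minus n \<and>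
         [:1, 1:] ^ m dvd R_lt_plus n \<and> [:1, 1:] ^ m dvd R_lt_minus n"
proof -
  \<comment> \<open>The sign of the first letter survives, which gives closure of
    \<open>B_gt n\<close> and \<open>B_lt n\<close>.\<close>
  have first: "letter (neg_suffix d w) (Suc 0) = letter w (Suc 0)"
    if "w \<in> signed_perms n" "Suc 0 \<le> d" for d w
    using that assms(1) length_signed_perm[of w n] by (simp add: letter_neg_suffix)
  show ?thesis
    unfolding assms(2) R_gt_plus_def R_gt_minus_def R_lt_plus_def R_lt_minus_def
    by (intro conjI; rule power_dvd_altruns_poly)
      (auto simp: B_gt_def B_lt_def B_plus_def B_minus_def first even_inv_B_neg_suffix)
qed

end
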